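(* Suppose that an arbitrary group $G$ acts acylindrically (by isometries) on any proper metric space $X$. Then either $X$ is bounded or $G$ acts metrically properly on $X$.
   Context: A metric space is proper if all closed balls are compact. An isometric action of $G$ on $X$ is acylindrical if for every $\epsilon\ge 0$ there are $N$ and $R$ such that for any two points $x,y\in X$ with $d(x,y)\ge R$ there are at most $N$ elements $g\in G$ with $d(g(x),x)\le\epsilon$ and $d(g(y),y)\le\epsilon$. The action is metrically proper if for every $x_0\in X$ and $r\ge 0$ the set $\{g\in G: d(g(x_0),x_0)\le r\}$ is finite. *)

theory Defs
  imports "HOL-Analysis.Abstract_Metric_Spaces" "HOL-Algebra.Group_Action"
begin

definition (in Metric_space) proper_space :: bool
  where "proper_space \<longleftrightarrow> (\<forall>x\<in>M. \<forall>r. compactin mtopology (mcball x r))"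

text \<open>
  Each \<open>\<phi> g\<close> is a bijection of \<open>X\<close> by \<^locale>\<open>group_action\<close>, so preserving
  distances makes it an isometry of \<open>X\<close> onto itself.
\<close>

locale isometric_action = group_action G X \<phi> + Metric_space X d
  for G :: "('g, 'z) monoid_scheme" (structure)
    and X :: "'a set" and \<phi> :: "'g \<Rightarrow> 'a \<Rightarrow> 'a" and d :: "'a \<Rightarrow> 'a \<Rightarrow> real" +
  assumes isometric:
    "\<lbrakk>g \<in> carrier G; x \<in> X; y \<in> X\<rbrakk> \<Longrightarrow> d (\<phi> g x) (\<phi> g y) = d x y"
begin

text \<open>
  The finiteness conjunct is needed because \<^const>\<open>card\<close> is \<open>0\<close> on infinite sets.
  Elements of \<open>G\<close> are counted, not the induced maps: the action need not be faithful.
\<close>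

definition acylindrical :: bool
  where "acylindrical \<longleftrightarrow>
    (\<forall>\<epsilon>\<ge>0. \<exists>N::nat. \<exists>R::real. \<forall>x\<in>X. \<forall>y\<in>X. d x y \<ge> R \<longrightarrow>
      finite {g \<in> carrier G. d (\<phi> g x) x \<le> \<epsilon> \<and> d (\<phi> g y) y \<le> \<epsilon>} \<and>
      card {g \<in> carrier G. d (\<phi> g x) x \<le> \<epsilon> \<and> d (\<phi> g y) y \<le> \<epsilon>} \<le> N)"

definition metrically_proper :: bool
  where "metrically_proper \<longleftrightarrow>
    (\<forall>x\<^sub>0\<in>X. \<forall>r\<ge>0. finite {g \<in> carrier G. d (\<phi> g x\<^sub>0) x\<^sub>0 \<le> r})"

end

end

theory Submission
  imports Defs
begin

text \<open>
  If infinitely many \<open>g\<close> move \<open>x\<close> by at most \<open>r\<close>, pick \<open>y\<close> far from \<open>x\<close>: the points \<open>g x\<close>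
  and \<open>g y\<close> stay in fixed, hence totally bounded, balls around \<open>x\<close>. By the pigeonhole principle
  infinitely many of the \<open>g\<close> agree up to \<open>1\<close> with a single \<open>h\<close> at both \<open>x\<close> and \<open>y\<close>, and the
  infinitely many \<open>h\<^sup>-\<^sup>1 g\<close> contradict acylindricity for \<open>\<epsilon> = 1\<close>.
\<close>

text \<open>Finitely many balls of radius \<open>e/2\<close> cover \<open>S\<close>, so infinitely
  many values of \<open>f\<close> fall into one of them, and any two of these are within
  \<open>e\<close> through its centre.\<close>

lemma (in Metric_space) infinite_close_subset:
  assumes "infinite A" and "mtotally_bounded S" and "\<And>a. a \<in> A \<Longrightarrow> f a \<in> S" and "0 < e"
  obtains B where "B \<subseteq> A" and "infinite B" and "\<And>a b. a \<in> B \<Longrightarrow> b \<in> B \<Longrightarrow> d (f a) (f b) \<le> e"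
proof -
  obtain K where K: "finite K" "S \<subseteq> (\<Union>z\<in>K. mball z (e/2))"
    using assms(2,4) unfolding mtotally_bounded_def by (meson half_gt_zero)
  then have "\<forall>a\<in>A. \<exists>z\<in>K. f a \<in> mball z (e/2)"
    using assms(3) by blast
  then obtain c where c: "\<And>a. a \<in> A \<Longrightarrow> c a \<in> K \<and> f a \<in> mball (c a) (e/2)"
    by metis
  have "finite (c ` A)"
    using c K(1) by (meson finite_subset image_subsetI)
  \<comment> \<open>The map \<open>c\<close> has finite range on the infinite set \<open>A\<close>,
    so one of its fibres is infinite.\<close>
  then obtain a0 where a0: "infinite {a \<in> A. c a = c a0}"
    using pigeonhole_infinite[OF assms(1)] by blast
  show thesis
  proof (rule that[OF _ a0])
    fix a b assume "a \<in> {a \<in> A. c a = c a0}" "b \<in> {a \<in> A. c a = c a0}"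
    then have "f a \<in> mball (c a0) (e/2)" "f b \<in> mball (c a0) (e/2)"
      using c by fastforce+
    then show "d (f a) (f b) \<le> e"
      using triangle[of "f a" "c a0" "f b"] commute[of "f a" "c a0"] by auto
  qed auto
qed

context isometric_action
begin

text \<open>Apply the isometry \<open>\<phi> (inv h)\<close> to both \<open>\<phi> g x\<close> and
  \<open>\<phi> h x\<close>. This converts closeness of \<open>g\<close> and \<open>h\<close> at a
  point into a small displacement by a single group element.\<close>

lemma dist_inv_mult:
  assumes "g \<in> carrier G" "h \<in> carrier G" "x \<in> X"
  shows "d (\<phi> (inv h \<otimes> g) x) x = d (\<phi> g x) (\<phi> h x)"
proof -
  interpret group G using group_hom by (simp add: group_hom_def)
  have "d (\<phi> (inv h \<otimes> g) x) x = d (\<phi> (inv h) (\<phi> g x)) (\<phi> (inv h) (\<phi> h x))"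
    using assms composition_rule orbit_sym_aux by simp
  also have "\<dots> = d (\<phi> g x) (\<phi> h x)"
    using assms by (intro isometric element_image[OF _ _ refl] inv_closed)
  finally show ?thesis .
qed

lemma acylindrical_imp_metrically_proper:
  assumes proper: "proper_space" and acyl: "acylindrical" and unbounded: "\<not> mbounded X"
  shows "metrically_proper"
  unfolding metrically_proper_def
proof (intro ballI allI impI)
  interpret group G using group_hom by (simp add: group_hom_def)
  fix x and r :: real assume x: "x \<in> X"
  obtain R where R: "\<And>y z. y \<in> X \<Longrightarrow> z \<in> X \<Longrightarrow> R \<le> d y z \<Longrightarrow>
      finite {g \<in> carrier G. d (\<phi> g y) y \<le> 1 \<and> d (\<phi> g z) z \<le> 1}"
    using acyl[unfolded acylindrical_def, rule_format, of 1] by auto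
  \<comment> \<open>Otherwise \<open>X\<close> would lie in \<open>mcball x R\<close> and be
    bounded.\<close>
  obtain y where y: "y \<in> X" "R \<le> d x y"
    using unbounded x unfolding mbounded_def
    by (auto simp: subset_iff not_le dest!: spec[of _ x] spec[of _ R] intro: less_imp_le)
  have tb: "mtotally_bounded (mcball x s)" for s
    using proper x compactin_imp_mtotally_bounded unfolding proper_space_def by blast
  show "finite {g \<in> carrier G. d (\<phi> g x) x \<le> r}"
  proof (rule ccontr)
    let ?A = "{g \<in> carrier G. d (\<phi> g x) x \<le> r}"
    assume inf: "infinite ?A"
    have bnd_x: "\<phi> g x \<in> mcball x r" if "g \<in> ?A" for g
      using that x element_image commute by auto
    obtain B where B: "B \<subseteq> ?A" "infinite B"
      "\<And>g h. g \<in> B \<Longrightarrow> h \<in> B \<Longrightarrow> d (\<phi> g x) (\<phi> h x) \<le> 1"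
      by (rule infinite_close_subset[where f = "\<lambda>g. \<phi> g x", OF inf tb _ zero_less_one])
        (rule bnd_x, assumption, rule that)
    \<comment> \<open>The radius is independent of \<open>g\<close>: \<open>\<phi> g x\<close> is
      within \<open>r\<close> of \<open>x\<close>, and \<open>\<phi> g y\<close> stays at distance
      \<open>d x y\<close> from it.\<close>
    have bnd_y: "\<phi> g y \<in> mcball x (r + d x y)" if "g \<in> B" for g
    proof -
      have g: "g \<in> carrier G" "d (\<phi> g x) x \<le> r" and im: "\<phi> g x \<in> X" "\<phi> g y \<in> X"
        using that B(1) x y(1) element_image by auto
      have "d x (\<phi> g y) \<le> d x (\<phi> g x) + d (\<phi> g x) (\<phi> g y)"
        using triangle x im by blast
      also have "\<dots> \<le> r + d x y"
        using g isometric x y(1) commute by simp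
      finally show ?thesis using x im by simp
    qed
    \<comment> \<open>Refining inside \<open>B\<close> keeps the closeness at \<open>x\<close> while
      adding it at \<open>y\<close>.\<close>
    obtain C where C: "C \<subseteq> B" "infinite C"
      "\<And>g h. g \<in> C \<Longrightarrow> h \<in> C \<Longrightarrow> d (\<phi> g y) (\<phi> h y) \<le> 1"
      by (rule infinite_close_subset[where f = "\<lambda>g. \<phi> g y", OF B(2) tb _ zero_less_one])
        (rule bnd_y, assumption, rule that)
    obtain h where h: "h \<in> C" using C(2) infinite_imp_nonempty by blast
    have carr: "C \<subseteq> carrier G" using B(1) C(1) by blast
    have "(\<lambda>g. inv h \<otimes> g) ` C \<subseteq> {g \<in> carrier G. d (\<phi> g x) x \<le> 1 \<and> d (\<phi> g y) y \<le> 1}"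
      using B(3) C(1,3) h carr x y(1) by (auto simp: dist_inv_mult subset_iff)
    \<comment> \<open>By left cancellation the translates of \<open>C\<close> remain infinitely
      many.\<close>
    moreover have "inj_on (\<lambda>g. inv h \<otimes> g) C"
      using carr h by (auto intro!: inj_onI simp: subset_iff)
    ultimately show False
      using R[OF x y] C(2) by (meson finite_imageD finite_subset)
  qed
qed

end

theorem theorem7p1:
  fixes G :: "('g, 'z) monoid_scheme"
    and X :: "'a set" and \<phi> :: "'g \<Rightarrow> 'a \<Rightarrow> 'a" and d :: "'a \<Rightarrow> 'a \<Rightarrow> real"
  assumes "isometric_action G X \<phi> d"
    and "Metric_space.proper_space X d"
    and "isometric_action.acylindrical G X \<phi> d"
  shows "Metric_space.mbounded X d X \<or> isometric_action.metrically_proper G X \<phi> d"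
  using isometric_action.acylindrical_imp_metrically_proper[OF assms] by blast

end
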